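(* Let $\mathcal{G}$ be a two-player hold'em game modeled as a signal observation ordered game, and let $i\in\{1,2\}$. Then the potential-aware outcome isomorphism (PAOI) abstraction for player $i$ is a resolution bound of the expected hand strength (EHS) algorithm; that is, for every choice of parameters of EHS, the signal observation abstraction for player $i$ produced by EHS is refined by the PAOI abstraction. Equivalently: for every phase $r\in\{1,\dots,\Gamma\}$ and all signal observation infosets $\psi,\psi'\in\Psi_i^{(r)}$ belonging to the same phase-$r$ PAOI class, EHS assigns $\psi$ and $\psi'$ to the same phase-$r$ cluster, for every choice of its parameters.
   Context: Only the signal (card-dealing) structure of the game matters; the players' betting actions play no role. **Signal structure of a two-player hold'em game.** There are phases $1,\dots,\Gamma$; chance deals once at the start of each phase. A phase-$r$ signal is a sequence of $r$ chance actions (deals); $\Theta^{(r)}$ is the finite nonempty set of phase-$r$ signals, and $\Theta^{(0)}$ consists of the empty sequence. Write $\theta\sqsubseteq\theta'$ if $\theta$ is a prefix of $\theta'$; each $\theta\in\Theta^{(r)}$, $r\ge1$, has its immediate predecessor in $\Theta^{(r-1)}$, and the elements of $\Theta^{(r+1)}$ with immediate predecessor $\theta\in\Theta^{(r)}$ are the successors of $\theta$. $\xi(\theta,\theta')$ denotes the probability that chance, after signal $\theta\in\Theta^{(r)}$, deals so as to reveal $\theta'\in\Theta^{(r+1)}$. In hold'em games all signals of the same phase $r<\Gamma$ have the same number $M_r\ge1$ of successors, and $\xi(\theta,\theta')=1/M_r$ if $\theta'$ is a successor of $\theta\in\Theta^{(r)}$, and $\xi(\theta,\theta')=0$ otherwise.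 The reach probability of a signal is $\pi_c(\theta)=\prod_{\theta'\sqsubseteq\theta,\ \theta'\text{ nonempty}}\xi(\theta'',\theta')$, with $\theta''$ the immediate predecessor of $\theta'$. For player $i$, $\Psi_i^{(r)}$ is a partition of $\Theta^{(r)}$ into nonempty signal observation infosets (signals in the same cell are indistinguishable to $i$). Standing assumption (perfect recall): for $r<\Gamma$, the immediate predecessors of all signals in a given $\psi'\in\Psi_i^{(r+1)}$ lie in one common $\psi\in\Psi_i^{(r)}$. Each final signal $\theta\in\Theta^{(\Gamma)}$ induces a reflexive, total, transitive relation $\preceq_\theta$ on $\{1,2\}$. Write $-i$ for the opponent of $i$. At $\theta$, player $i$ wins if $-i\preceq_\theta i$ and $i\not\preceq_\theta -i$, ties if $i\preceq_\theta -i$ and $-i\preceq_\theta i$, and loses if $i\preceq_\theta -i$ and $-i\not\preceq_\theta i$. **PAOI.** Potential-aware outcome features (PAOFs) $pf^{(r)}(\psi)$, $\psi\in\Psi_i^{(r)}$, and PAOI classes are defined by backward recursion on $r$; two infosets of $\Psi_i^{(r)}$ are in the same phase-$r$ PAOI class iff they have equal PAOFs. Let $pi_1^{(r)},\dots,pi_{\mathcal{C}^{(r)}}^{(r)}$ denote the distinct phase-$r$ PAOI classes (each a set of infosets in $\Psi_i^{(r)}$). - For $r=\Gamma$: $pf^{(\Gamma)}(\psi)$ is the triple of (losing, tying, winning) probabilities of player $i$ under the distribution on $\psi$ proportional to $\pi_c$; e.g. the winning component is $\sum_{\theta\in\psi}\pi_c(\theta)\,\mathbb{I}\{i\text{ wins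 at }\theta\}\big/\sum_{\theta\in\psi}\pi_c(\theta)$. - For $r<\Gamma$: $pf^{(r)}(\psi)=(pf_j^{(r)}(\psi))_{j=1}^{\mathcal{C}^{(r+1)}}$ with $$pf_j^{(r)}(\psi)=\frac{\sum_{\theta\in\psi}\pi_c(\theta)\sum_{\psi'\in pi_j^{(r+1)}}\sum_{\theta'\in\psi'}\xi(\theta,\theta')}{\sum_{\theta\in\psi}\pi_c(\theta)\sum_{\theta'\in\Theta^{(r+1)}}\xi(\theta,\theta')}.$$ The PAOI abstraction merges, in each phase, all infosets in the same PAOI class. **EHS.** For $\psi\in\Psi_i^{(r)}$ let $S_\psi^{(\Gamma)}=\{\theta\in\Theta^{(\Gamma)}:\exists\theta'\in\psi,\ \theta'\sqsubseteq\theta\}$. Let $w(\psi)$ and $t(\psi)$ be the winning and tying rates $$w(\psi)=\frac{\sum_{\theta\in S_\psi^{(\Gamma)}}\pi_c(\theta)\,\mathbb{I}\{i\text{ wins at }\theta\}}{\sum_{\theta\in S_\psi^{(\Gamma)}}\pi_c(\theta)},\qquad t(\psi)=\frac{\sum_{\theta\in S_\psi^{(\Gamma)}}\pi_c(\theta)\,\mathbb{I}\{i\text{ ties at }\theta\}}{\sum_{\theta\in S_\psi^{(\Gamma)}}\pi_c(\theta)},$$ and $\mathrm{equity}(\psi)=w(\psi)+\tfrac12 t(\psi)\in[0,1]$. The parameters of EHS are, for each phase $r$, a number of clusters $n$ and a division of $[0,1]$ into $n$ contiguous disjoint intervals (for example $[0,1/n],(1/n,2/n],\dots,((n-1)/n,1]$).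 EHS puts two infosets of $\Psi_i^{(r)}$ in the same phase-$r$ cluster iff their equities lie in the same interval. **Refinement and resolution bound.** A signal observation abstraction for player $i$ is a coarsening of the partitions $\Psi_i^{(r)}$ (each abstract cell is a union of infosets). An abstraction refines another if every cell of the latter is a union of cells of the former. An abstraction is a resolution bound of an abstraction algorithm (for the given game and player) if it refines every abstraction the algorithm generates, for every choice of the algorithm's parameters. *)

theory Defs
  imports "HOL-Analysis.Analysis" "HOL-Library.Sublist" "HOL-Library.Disjoint_Sets"
begin

section \<open>Signal structure of two-player hold'em games\<close>

datatype player = P1 | P2

fun opponent :: "player \<Rightarrow> player" where
  "opponent P1 = P2"
| "opponent P2 = P1"

text \<open>
  A signal is the list of deals made so far, oldest first, so a phase-\<open>r\<close> signal is a list
  of length \<open>r\<close>. The field \<open>outcome_le \<theta>\<close> is the relation that a final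
  signal \<open>\<theta>\<close> induces on the players.
\<close>

record 'a holdem =
  phases :: nat
  signals :: "nat \<Rightarrow> 'a list set"
  deal_prob :: "'a list \<Rightarrow> 'a list \<Rightarrow> real"
  infosets :: "player \<Rightarrow> nat \<Rightarrow> 'a list set set"
  outcome_le :: "'a list \<Rightarrow> player \<Rightarrow> player \<Rightarrow> bool"

definition successors :: "'a holdem \<Rightarrow> nat \<Rightarrow> 'a list \<Rightarrow> 'a list set" where
  "successors G r \<theta> = {\<theta>' \<in> signals G (Suc r). butlast \<theta>' = \<theta>}"

definition holdem_game :: "'a holdem \<Rightarrow> bool" where
  "holdem_game G \<longleftrightarrow>
     1 \<le> phases G
   \<and> signals G 0 = {[]}
   \<and> (\<forall>r \<in> {1..phases G}.
        finite (signals G r) \<and> signals G r \<noteq> {}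
      \<and> (\<forall>\<theta> \<in> signals G r. length \<theta> = r \<and> butlast \<theta> \<in> signals G (r - 1)))
   \<and> (\<forall>r < phases G. \<exists>M \<ge> 1. \<forall>\<theta> \<in> signals G r.
        card (successors G r \<theta>) = M
      \<and> (\<forall>\<theta>' \<in> signals G (Suc r).
           deal_prob G \<theta> \<theta>' = (if \<theta>' \<in> successors G r \<theta> then 1 / real M else 0)))
   \<and> (\<forall>i. \<forall>r \<in> {1..phases G}. partition_on (signals G r) (infosets G i r))
   \<and> (\<forall>i. \<forall>r \<in> {1..<phases G}. \<forall>\<psi>' \<in> infosets G i (Suc r).
        \<exists>\<psi> \<in> infosets G i r. \<forall>\<theta>' \<in> \<psi>'. butlast \<theta>' \<in> \<psi>)
   \<and> (\<forall>\<theta> \<in> signals G (phases G).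
        reflp (outcome_le G \<theta>) \<and> totalp (outcome_le G \<theta>) \<and> transp (outcome_le G \<theta>))"

definition reach_prob :: "'a holdem \<Rightarrow> 'a list \<Rightarrow> real" where
  "reach_prob G \<theta> =
     (\<Prod>\<theta>' \<in> {\<theta>'. prefix \<theta>' \<theta> \<and> \<theta>' \<noteq> []}. deal_prob G (butlast \<theta>') \<theta>')"

definition wins :: "'a holdem \<Rightarrow> player \<Rightarrow> 'a list \<Rightarrow> bool" where
  "wins G i \<theta> \<longleftrightarrow>
     outcome_le G \<theta> (opponent i) i \<and> \<not> outcome_le G \<theta> i (opponent i)"

definition ties :: "'a holdem \<Rightarrow> player \<Rightarrow> 'a list \<Rightarrow> bool" where
  "ties G i \<theta> \<longleftrightarrow>
     outcome_le G \<theta> i (opponent i) \<and> outcome_le G \<theta> (opponent i) i"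

definition loses :: "'a holdem \<Rightarrow> player \<Rightarrow> 'a list \<Rightarrow> bool" where
  "loses G i \<theta> \<longleftrightarrow>
     outcome_le G \<theta> i (opponent i) \<and> \<not> outcome_le G \<theta> (opponent i) i"

definition event_rate :: "'a holdem \<Rightarrow> 'a list set \<Rightarrow> ('a list \<Rightarrow> bool) \<Rightarrow> real" where
  "event_rate G S P =
     (\<Sum>\<theta> \<in> S. reach_prob G \<theta> * of_bool (P \<theta>)) / (\<Sum>\<theta> \<in> S. reach_prob G \<theta>)"


section \<open>Potential-aware outcome isomorphism\<close>

definition feature_classes :: "'b set \<Rightarrow> ('b \<Rightarrow> 'c) \<Rightarrow> 'b set set" where
  "feature_classes A f = (\<lambda>x. {y \<in> A. f y = f x}) ` A"

text \<open>
  An arbitrary but fixed numbering of a finite set; it supplies the indices \<open>j\<close> of the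
  classes at the next phase. Its order does not affect which features are equal.
\<close>

definition enumeration :: "'b set \<Rightarrow> 'b list" where
  "enumeration A = (SOME xs. distinct xs \<and> set xs = A)"

text \<open>
  Potential-aware outcome features. The final-phase triple and the feature vectors of the
  earlier phases, whose length is the number of classes of the next phase, are both
  represented as lists of reals.
\<close>

function paof :: "'a holdem \<Rightarrow> player \<Rightarrow> nat \<Rightarrow> 'a list set \<Rightarrow> real list" where
  "paof G i r \<psi> =
     (if r < phases G then
        map (\<lambda>C. (\<Sum>\<theta> \<in> \<psi>. reach_prob G \<theta> *
                    (\<Sum>\<psi>' \<in> C. \<Sum>\<theta>' \<in> \<psi>'. deal_prob G \<theta> \<theta>'))
               / (\<Sum>\<theta> \<in> \<psi>. reach_prob G \<theta> *
                    (\<Sum>\<theta>' \<in> signals G (Suc r). deal_prob G \<theta> \<theta>')))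
          (enumeration (feature_classes (infosets G i (Suc r)) (paof G i (Suc r))))
      else
        [event_rate G \<psi> (loses G i), event_rate G \<psi> (ties G i), event_rate G \<psi> (wins G i)])"
  by pat_completeness auto
termination
  by (relation "Wellfounded.measure (\<lambda>(G, i, r, \<psi>). phases G - r)") auto

declare paof.simps [simp del]

definition paoi_classes :: "'a holdem \<Rightarrow> player \<Rightarrow> nat \<Rightarrow> 'a list set set set" where
  "paoi_classes G i r = feature_classes (infosets G i r) (paof G i r)"

definition paoi :: "'a holdem \<Rightarrow> player \<Rightarrow> nat \<Rightarrow> 'a list set set" where
  "paoi G i r = Union ` paoi_classes G i r"


section \<open>Expected hand strength\<close>

definition final_extensions :: "'a holdem \<Rightarrow> 'a list set \<Rightarrow> 'a list set" where
  "final_extensions G \<psi> = {\<theta> \<in> signals G (phases G). \<exists>\<theta>' \<in> \<psi>. prefix \<theta>' \<theta>}"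

definition equity :: "'a holdem \<Rightarrow> player \<Rightarrow> 'a list set \<Rightarrow> real" where
  "equity G i \<psi> =
     event_rate G (final_extensions G \<psi>) (wins G i)
     + 1 / 2 * event_rate G (final_extensions G \<psi>) (ties G i)"

text \<open>
  A partition of the unit interval into finitely many intervals is automatically contiguous.
  The intervals may be open, closed, half-open or single points.
\<close>

definition interval_division :: "nat \<Rightarrow> real set set \<Rightarrow> bool" where
  "interval_division n D \<longleftrightarrow>
     partition_on {0..1} D \<and> finite D \<and> card D = n \<and> (\<forall>J \<in> D. is_interval J)"

definition ehs_params :: "'a holdem \<Rightarrow> (nat \<Rightarrow> nat \<times> real set set) set" where
  "ehs_params G = {p. \<forall>r \<in> {1..phases G}. interval_division (fst (p r)) (snd (p r))}"

definition ehs_clusters ::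
    "'a holdem \<Rightarrow> player \<Rightarrow> (nat \<Rightarrow> nat \<times> real set set) \<Rightarrow> nat \<Rightarrow> 'a list set set set" where
  "ehs_clusters G i p r =
     (\<lambda>J. {\<psi> \<in> infosets G i r. equity G i \<psi> \<in> J}) ` snd (p r) - {{}}"

definition ehs ::
    "'a holdem \<Rightarrow> player \<Rightarrow> (nat \<Rightarrow> nat \<times> real set set) \<Rightarrow> nat \<Rightarrow> 'a list set set" where
  "ehs G i p r = Union ` ehs_clusters G i p r"


section \<open>Abstractions, refinement and resolution bounds\<close>

definition signal_abstraction ::
    "'a holdem \<Rightarrow> player \<Rightarrow> (nat \<Rightarrow> 'a list set set) \<Rightarrow> bool" where
  "signal_abstraction G i \<alpha> \<longleftrightarrow>
     (\<forall>r \<in> {1..phases G}. partition_on (signals G r) (\<alpha> r)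
        \<and> (\<forall>c \<in> \<alpha> r. \<exists>S \<subseteq> infosets G i r. c = \<Union>S))"

definition abstraction_refines ::
    "'a holdem \<Rightarrow> player \<Rightarrow> (nat \<Rightarrow> 'a list set set) \<Rightarrow> (nat \<Rightarrow> 'a list set set) \<Rightarrow> bool" where
  "abstraction_refines G i \<alpha> \<beta> \<longleftrightarrow>
     signal_abstraction G i \<alpha> \<and> signal_abstraction G i \<beta>
     \<and> (\<forall>r \<in> {1..phases G}. \<forall>c \<in> \<beta> r. \<exists>S \<subseteq> \<alpha> r. c = \<Union>S)"

text \<open>
  An abstraction algorithm is given by its set of admissible parameters and the map sending
  a parameter to the abstraction it produces.
\<close>

definition resolution_bound ::
    "'a holdem \<Rightarrow> player \<Rightarrow> (nat \<Rightarrow> 'a list set set)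
      \<Rightarrow> 'p set \<Rightarrow> ('p \<Rightarrow> nat \<Rightarrow> 'a list set set) \<Rightarrow> bool" where
  "resolution_bound G i \<alpha> params alg \<longleftrightarrow>
     signal_abstraction G i \<alpha> \<and> (\<forall>p \<in> params. abstraction_refines G i \<alpha> (alg p))"

end

theory Submission
  imports Defs
begin

text \<open>
  The winning and tying rates of an infoset are functions of its potential-aware outcome
  feature. At the final phase they are components of the feature. At an earlier phase, perfect
  recall places every infoset of the next phase either entirely below \<open>\<psi>\<close> or
  entirely off it, so the law of total probability writes the rate of \<open>\<psi>\<close> as the
  average of the rates of the next-phase infosets, weighted by the transition probabilities from
  \<open>\<psi>\<close>. By backward induction the rate is constant on each next-phase class, and the
  total transition probability into a class is a component of the feature of \<open>\<psi>\<close>.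
  Hence equal features force equal equities.
\<close>

section \<open>Partitions and feature classes\<close>

lemma partition_on_feature_classes: "partition_on A (feature_classes A f)"
  by (rule partition_onI) (auto simp: feature_classes_def disjnt_def)

text \<open>A finite set has a distinct listing, so the choice is meaningful. This ensures that a
  feature vector has a component for every class.\<close>

lemma set_enumeration:
  assumes "finite A"
  shows "set (enumeration A) = A"
  unfolding enumeration_def
  by (metis (mono_tags, lifting) someI_ex assms finite_distinct_list)

text \<open>Applied with \<open>f\<close> the equity and \<open>D\<close> the division of the unit
  interval. Empty preimages are dropped because an interval may contain no equity.\<close>

lemma partition_on_preimages:
  assumes "partition_on B D" "f ` A \<subseteq> B"
  shows "partition_on A ((\<lambda>J. {x \<in> A. f x \<in> J}) ` D - {{}})"
proof (rule partition_onI)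
  show "\<Union> ((\<lambda>J. {x \<in> A. f x \<in> J}) ` D - {{}}) = A"
  proof
    show "A \<subseteq> \<Union> ((\<lambda>J. {x \<in> A. f x \<in> J}) ` D - {{}})"
    proof
      fix x assume "x \<in> A"
      then obtain J where "J \<in> D" "f x \<in> J"
        using assms by (auto simp: partition_on_def)
      then show "x \<in> \<Union> ((\<lambda>J. {x \<in> A. f x \<in> J}) ` D - {{}})"
        using \<open>x \<in> A\<close> by blast
    qed
  qed blast
  show "disjnt p q" if pq: "p \<in> (\<lambda>J. {x \<in> A. f x \<in> J}) ` D - {{}}"
    "q \<in> (\<lambda>J. {x \<in> A. f x \<in> J}) ` D - {{}}" "p \<noteq> q" for p q
  proof -
    obtain I J where IJ: "I \<in> D" "J \<in> D" "p = {x \<in> A. f x \<in> I}" "q = {x \<in> A. f x \<in> J}"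
      using pq(1,2) by blast
    then have "I \<inter> J = {}"
      using pq(3) assms(1) disjointD[of D I J] by (auto simp: partition_on_def)
    then show ?thesis
      unfolding IJ disjnt_def by blast
  qed
qed auto

text \<open>Passes from classes of infosets to cells of signals: distinct classes share no infoset,
  and distinct infosets share no signal.\<close>

lemma partition_on_Union_image:
  assumes "partition_on S A" "partition_on A K"
  shows "partition_on S (Union ` K)"
proof (rule partition_onI)
  show "\<Union> (Union ` K) = S"
    using assms by (auto simp: partition_on_def)
  show "disjnt p q" if pq: "p \<in> Union ` K" "q \<in> Union ` K" "p \<noteq> q" for p q
  proof -
    obtain k l where kl: "k \<in> K" "l \<in> K" "p = \<Union>k" "q = \<Union>l"
      using pq(1,2) by blast
    moreover have "k \<noteq> l"
      using pq(3) kl by blast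
    ultimately have "k \<inter> l = {}" "k \<subseteq> A" "l \<subseteq> A"
      using assms(2) by (auto simp: partition_on_def dest: disjointD)
    have "a \<inter> b = {}" if "a \<in> k" "b \<in> l" for a b
    proof -
      have "a \<noteq> b" "a \<in> A" "b \<in> A"
        using that \<open>k \<inter> l = {}\<close> \<open>k \<subseteq> A\<close> \<open>l \<subseteq> A\<close> by auto
      then show ?thesis
        using assms(1) by (auto simp: partition_on_def dest: disjointD)
    qed
    then show ?thesis
      unfolding kl disjnt_def by blast
  qed
  \<comment> \<open>An empty union would force a class to be empty or to contain an empty
    infoset.\<close>
  have "{} \<notin> A" "{} \<notin> K" "\<And>k. k \<in> K \<Longrightarrow> k \<subseteq> A"
    using assms by (auto simp: partition_on_def)
  then show "{} \<notin> Union ` K"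
    by (metis Sup_bot_conv(1) ex_in_conv imageE subsetD)
qed

text \<open>The \<open>K\<close>-cell of a point of \<open>l\<close> lies inside some cell of
  \<open>L\<close>; that cell meets \<open>l\<close> and hence equals it.\<close>

lemma Union_of_finer_cells:
  assumes "partition_on A K" "partition_on A L" "l \<in> L"
    and "\<And>k. k \<in> K \<Longrightarrow> \<exists>l \<in> L. k \<subseteq> l"
  shows "l = \<Union>{k \<in> K. k \<subseteq> l}"
proof
  show "l \<subseteq> \<Union>{k \<in> K. k \<subseteq> l}"
  proof
    fix x assume "x \<in> l"
    then obtain k where k: "k \<in> K" "x \<in> k"
      using assms(1-3) by (auto simp: partition_on_def)
    then obtain l' where "l' \<in> L" "k \<subseteq> l'"
      using assms(4) by blast
    then have "l' = l"
      using \<open>x \<in> l\<close> k assms(2,3) by (auto simp: partition_on_def dest: disjointD)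
    then show "x \<in> \<Union>{k \<in> K. k \<subseteq> l}"
      using k \<open>k \<subseteq> l'\<close> by blast
  qed
qed blast

lemma sum_over_partition:
  assumes "partition_on A D" "finite A"
  shows "(\<Sum>x\<in>A. g x) = (\<Sum>d\<in>D. \<Sum>x\<in>d. g x)"
proof -
  have "sum g (\<Union>D) = (sum \<circ> sum) g D"
    using assms
    by (intro sum.Union_disjoint) (auto simp: partition_on_def dest: disjointD intro: finite_subset)
  then show ?thesis
    using assms(1) by (simp add: partition_on_def)
qed


section \<open>Reach probabilities\<close>

locale holdem =
  fixes G :: "'a holdem"
  assumes game: "holdem_game G"
begin

section \<open>Finiteness, lengths, predecessors and recall from the game axioms\<close>

lemma finite_signals: "r \<le> phases G \<Longrightarrow> finite (signals G r)"
  using game by (cases r) (auto simp: holdem_game_def)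

lemma length_signal: "r \<le> phases G \<Longrightarrow> \<theta> \<in> signals G r \<Longrightarrow> length \<theta> = r"
  using game by (cases r) (auto simp: holdem_game_def)

lemma butlast_signal:
  "r < phases G \<Longrightarrow> \<theta> \<in> signals G (Suc r) \<Longrightarrow> butlast \<theta> \<in> signals G r"
  using game unfolding holdem_game_def
  by (metis Suc_eq_plus1 Suc_leI atLeastAtMost_iff diff_Suc_1 le_add2)

lemma partition_infosets:
  "r \<in> {1..phases G} \<Longrightarrow> partition_on (signals G r) (infosets G i r)"
  using game by (auto simp: holdem_game_def)

lemma infoset_subset: "r \<in> {1..phases G} \<Longrightarrow> \<psi> \<in> infosets G i r \<Longrightarrow> \<psi> \<subseteq> signals G r"
  using partition_infosets by (auto simp: partition_on_def)

lemma finite_infoset: "r \<in> {1..phases G} \<Longrightarrow> \<psi> \<in> infosets G i r \<Longrightarrow> finite \<psi>"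
  using infoset_subset finite_signals by (meson atLeastAtMost_iff finite_subset)

lemma finite_infosets: "r \<in> {1..phases G} \<Longrightarrow> finite (infosets G i r)"
  using partition_infosets finite_signals by (meson atLeastAtMost_iff finite_elements)

lemma perfect_recall:
  assumes "r \<in> {1..<phases G}" "\<psi>' \<in> infosets G i (Suc r)"
  obtains \<psi> where "\<psi> \<in> infosets G i r" "\<And>\<theta>'. \<theta>' \<in> \<psi>' \<Longrightarrow> butlast \<theta>' \<in> \<psi>"
proof -
  have "\<forall>i. \<forall>r \<in> {1..<phases G}. \<forall>\<psi>' \<in> infosets G i (Suc r).
      \<exists>\<psi> \<in> infosets G i r. \<forall>\<theta>' \<in> \<psi>'. butlast \<theta>' \<in> \<psi>"
    using game unfolding holdem_game_def by (elim conjE)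
  with assms show thesis
    using that by meson
qed

lemma deal_prob_uniform:
  assumes "r < phases G"
  obtains M where "M \<ge> 1" "\<And>\<theta>. \<theta> \<in> signals G r \<Longrightarrow> card (successors G r \<theta>) = M"
    "\<And>\<theta> \<theta>'. \<theta> \<in> signals G r \<Longrightarrow> \<theta>' \<in> signals G (Suc r) \<Longrightarrow>
      deal_prob G \<theta> \<theta>' = (if butlast \<theta>' = \<theta> then 1 / real M else 0)"
proof -
  obtain M where M: "M \<ge> 1" "\<forall>\<theta> \<in> signals G r.
        card (successors G r \<theta>) = M
      \<and> (\<forall>\<theta>' \<in> signals G (Suc r).
           deal_prob G \<theta> \<theta>' = (if \<theta>' \<in> successors G r \<theta> then 1 / real M else 0))"
  proof -
    have "\<forall>r < phases G. \<exists>M \<ge> 1. \<forall>\<theta> \<in> signals G r.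
        card (successors G r \<theta>) = M
      \<and> (\<forall>\<theta>' \<in> signals G (Suc r).
           deal_prob G \<theta> \<theta>' = (if \<theta>' \<in> successors G r \<theta> then 1 / real M else 0))"
      using game unfolding holdem_game_def by (elim conjE)
    with assms that show thesis
      by meson
  qed
  show thesis
    by (rule that[OF M(1)]) (use M(2) in \<open>auto simp: successors_def\<close>)
qed

lemma deal_prob_nonsuccessor:
  assumes "r < phases G" "\<theta> \<in> signals G r" "\<theta>' \<in> signals G (Suc r)" "butlast \<theta>' \<noteq> \<theta>"
  shows "deal_prob G \<theta> \<theta>' = 0"
  using deal_prob_uniform[OF assms(1)] assms(2-) by metis

lemma deal_prob_pos:
  assumes "r < phases G" "\<theta>' \<in> signals G (Suc r)"
  shows "deal_prob G (butlast \<theta>') \<theta>' > 0"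
proof -
  obtain M where "M \<ge> 1" "deal_prob G (butlast \<theta>') \<theta>' = 1 / real M"
    using deal_prob_uniform[OF assms(1)] butlast_signal[OF assms] assms(2) by metis
  then show ?thesis by simp
qed

text \<open>Each of the \<open>M\<close> successors contributes \<open>1 / M\<close>.\<close>

lemma sum_deal_prob:
  assumes "r < phases G" "\<theta> \<in> signals G r"
  shows "(\<Sum>\<theta>' \<in> signals G (Suc r). deal_prob G \<theta> \<theta>') = 1"
proof -
  obtain M where M: "M \<ge> 1" "card (successors G r \<theta>) = M"
    "\<And>\<theta>'. \<theta>' \<in> signals G (Suc r) \<Longrightarrow>
      deal_prob G \<theta> \<theta>' = (if butlast \<theta>' = \<theta> then 1 / real M else 0)"
    using deal_prob_uniform[OF assms(1)] assms(2) by metis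
  have fin: "finite (signals G (Suc r))"
    using assms(1) finite_signals by simp
  have "(\<Sum>\<theta>' \<in> signals G (Suc r). deal_prob G \<theta> \<theta>') =
      (\<Sum>\<theta>' \<in> signals G (Suc r). if butlast \<theta>' = \<theta> then 1 / real M else 0)"
    using M(3) by (rule sum.cong[OF refl])
  also have "\<dots> = (\<Sum>\<theta>' \<in> successors G r \<theta>. 1 / real M)"
    unfolding successors_def by (rule sum.inter_filter[OF fin, symmetric])
  finally show ?thesis
    using M(1,2) by simp
qed

text \<open>The nonempty prefixes of \<theta> are those of its predecessor together with \<theta>
  itself, so the product gains exactly one factor.\<close>

lemma reach_prob_step:
  assumes "r < phases G" "\<theta> \<in> signals G (Suc r)"
  shows "reach_prob G \<theta> = reach_prob G (butlast \<theta>) * deal_prob G (butlast \<theta>) \<theta>"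
proof -
  have "\<theta> \<noteq> []"
    using length_signal[of "Suc r" \<theta>] assms by auto
  then have eq: "{\<theta>'. prefix \<theta>' \<theta> \<and> \<theta>' \<noteq> []}
      = insert \<theta> {\<theta>'. prefix \<theta>' (butlast \<theta>) \<and> \<theta>' \<noteq> []}"
    by (cases \<theta> rule: rev_cases) auto
  have fin: "finite {\<theta>'. prefix \<theta>' (butlast \<theta>) \<and> \<theta>' \<noteq> []}"
    by (rule finite_subset[of _ "set (prefixes (butlast \<theta>))"]) auto
  have notin: "\<theta> \<notin> {\<theta>'. prefix \<theta>' (butlast \<theta>) \<and> \<theta>' \<noteq> []}"
    using \<open>\<theta> \<noteq> []\<close> by (cases \<theta> rule: rev_cases) (auto dest: prefix_length_le)
  show ?thesis
    unfolding reach_prob_def eq using fin notin by (simp add: mult.commute)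
qed

lemma reach_prob_pos: "r \<le> phases G \<Longrightarrow> \<theta> \<in> signals G r \<Longrightarrow> reach_prob G \<theta> > 0"
proof (induction r arbitrary: \<theta>)
  case 0
  then show ?case
    using length_signal[of 0 \<theta>] by (simp add: reach_prob_def)
next
  case (Suc r)
  then show ?case
    using reach_prob_step[of r \<theta>] deal_prob_pos[of r \<theta>] butlast_signal[of r \<theta>] by simp
qed

text \<open>Lifts \<open>successors\<close> to sets, so that a whole infoset can be advanced by one
  deal.\<close>

definition succs :: "nat \<Rightarrow> 'a list set \<Rightarrow> 'a list set" where
  "succs r S = {\<theta>' \<in> signals G (Suc r). butlast \<theta>' \<in> S}"

text \<open>After exchanging the sums, only the predecessor of each \<theta>' contributes, and its
  term is the reach probability of \<theta>'. Numerators of features thus become reach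
  masses.\<close>

lemma sum_reach_deal:
  assumes "r < phases G" "S \<subseteq> signals G r" "T \<subseteq> signals G (Suc r)"
  shows "(\<Sum>\<theta> \<in> S. reach_prob G \<theta> * (\<Sum>\<theta>' \<in> T. deal_prob G \<theta> \<theta>'))
    = (\<Sum>\<theta>' \<in> T \<inter> succs r S. reach_prob G \<theta>')"
proof -
  have fin: "finite S" "finite T"
    using assms finite_signals finite_subset by (metis Suc_leI less_imp_le_nat)+
  have "(\<Sum>\<theta> \<in> S. reach_prob G \<theta> * deal_prob G \<theta> \<theta>')
      = (if butlast \<theta>' \<in> S then reach_prob G \<theta>' else 0)" if "\<theta>' \<in> T" for \<theta>'
  proof -
    have "(\<Sum>\<theta> \<in> S. reach_prob G \<theta> * deal_prob G \<theta> \<theta>')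
        = (\<Sum>\<theta> \<in> S. if butlast \<theta>' = \<theta> then reach_prob G \<theta>' else 0)"
      using that assms deal_prob_nonsuccessor[OF assms(1)] reach_prob_step[OF assms(1)]
      by (intro sum.cong) auto
    then show ?thesis
      using fin(1) by simp
  qed
  then have "(\<Sum>\<theta>' \<in> T. \<Sum>\<theta> \<in> S. reach_prob G \<theta> * deal_prob G \<theta> \<theta>')
      = (\<Sum>\<theta>' \<in> T. if butlast \<theta>' \<in> S then reach_prob G \<theta>' else 0)"
    by simp
  also have "\<dots> = (\<Sum>\<theta>' \<in> {\<theta>' \<in> T. butlast \<theta>' \<in> S}. reach_prob G \<theta>')"
    using fin(2) by (simp add: sum.inter_filter)
  also have "{\<theta>' \<in> T. butlast \<theta>' \<in> S} = T \<inter> succs r S"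
    using assms(3) by (auto simp: succs_def)
  finally show ?thesis
    by (simp add: sum_distrib_left sum.swap[of _ T S])
qed

text \<open>The deals after any signal have total probability 1, so the denominator of a feature is
  the reach mass of the infoset.\<close>

lemma sum_reach_total:
  assumes "r < phases G" "S \<subseteq> signals G r"
  shows "(\<Sum>\<theta> \<in> S. reach_prob G \<theta> * (\<Sum>\<theta>' \<in> signals G (Suc r). deal_prob G \<theta> \<theta>'))
    = (\<Sum>\<theta> \<in> S. reach_prob G \<theta>)"
  using assms sum_deal_prob by (intro sum.cong) auto

text \<open>Conservation of mass under one deal: \<open>sum_reach_deal\<close> with \<open>T\<close>
  the whole next phase.\<close>

lemma sum_reach_succs:
  assumes "r < phases G" "S \<subseteq> signals G r"
  shows "(\<Sum>\<theta>' \<in> succs r S. reach_prob G \<theta>') = (\<Sum>\<theta> \<in> S. reach_prob G \<theta>)"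
proof -
  have "signals G (Suc r) \<inter> succs r S = succs r S"
    by (auto simp: succs_def)
  then show ?thesis
    using sum_reach_deal[OF assms order_refl] sum_reach_total[OF assms] by simp
qed


section \<open>Final extensions\<close>

lemma final_extensions_final:
  "S \<subseteq> signals G (phases G) \<Longrightarrow> final_extensions G S = S"
proof -
  assume S: "S \<subseteq> signals G (phases G)"
  have "\<theta>' = \<theta>" if "prefix \<theta>' \<theta>" "\<theta>' \<in> S" "\<theta> \<in> signals G (phases G)" for \<theta> \<theta>'
  proof -
    have "length \<theta>' = length \<theta>"
      using that S length_signal[of "phases G"] by auto
    then show ?thesis
      using that(1) by (auto simp: prefix_def)
  qed
  then show ?thesis
    unfolding final_extensions_def using S by blast
qed

lemma take_signal:
  "n \<le> r \<Longrightarrow> r \<le> phases G \<Longrightarrow> \<theta> \<in> signals G r \<Longrightarrow> take n \<theta> \<in> signals G n"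
proof (induction r arbitrary: \<theta>)
  case 0
  then show ?case
    using length_signal[of 0 \<theta>] by simp
next
  case (Suc r)
  show ?case
  proof (cases "n = Suc r")
    case True
    then show ?thesis
      using Suc.prems length_signal[of "Suc r" \<theta>] by simp
  next
    case False
    then have "take n (butlast \<theta>) \<in> signals G n"
      using Suc butlast_signal[of r \<theta>] by simp
    moreover have "take n (butlast \<theta>) = take n \<theta>"
      using False Suc.prems length_signal[of "Suc r" \<theta>] by (simp add: butlast_conv_take)
    ultimately show ?thesis by simp
  qed
qed

text \<open>All members of \<open>S\<close> have length \<open>r\<close>, so the truncation to
  \<open>r\<close> deals is the only possible prefix in \<open>S\<close>. In this form disjoint sets
  visibly have disjoint final extensions.\<close>

lemma final_extensions_take:
  assumes "r \<le> phases G" "S \<subseteq> signals G r"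
  shows "final_extensions G S = {\<theta> \<in> signals G (phases G). take r \<theta> \<in> S}"
proof -
  have "(\<exists>\<theta>'\<in>S. prefix \<theta>' \<theta>) \<longleftrightarrow> take r \<theta> \<in> S" for \<theta>
    using assms length_signal by (metis in_mono append_eq_conv_conj prefix_def take_is_prefix)
  then show ?thesis
    by (simp add: final_extensions_def)
qed

lemma final_extensions_succs:
  assumes "r < phases G" "S \<subseteq> signals G r"
  shows "final_extensions G (succs r S) = final_extensions G S"
proof -
  have "succs r S \<subseteq> signals G (Suc r)"
    by (auto simp: succs_def)
  \<comment> \<open>Final signals have more than \<open>r\<close> deals, so dropping the last of the
    first \<open>Suc r\<close> deals leaves exactly \<open>r\<close>.\<close>
  moreover have "take (Suc r) \<theta> \<in> succs r S \<longleftrightarrow> take r \<theta> \<in> S" if "\<theta> \<in> signals G (phases G)" for \<theta>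
    using that assms(1) length_signal[of "phases G" \<theta>] take_signal[of "Suc r" "phases G" \<theta>]
    by (simp add: succs_def butlast_take)
  ultimately show ?thesis
    using assms by (auto simp: final_extensions_take[of r] final_extensions_take[of "Suc r"])
qed

text \<open>Mass is conserved at each deal. The induction descends from the final phase, with
  \<open>succs r S\<close> in the role of \<open>S\<close> one phase later.\<close>

lemma sum_reach_final_extensions:
  assumes "r \<le> phases G" "S \<subseteq> signals G r"
  shows "(\<Sum>\<theta> \<in> final_extensions G S. reach_prob G \<theta>) = (\<Sum>\<theta> \<in> S. reach_prob G \<theta>)"
  using assms
proof (induction r arbitrary: S rule: inc_induct)
  case base
  then show ?case by (simp add: final_extensions_final)
next
  case (step r)
  have "succs r S \<subseteq> signals G (Suc r)"
    by (auto simp: succs_def)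
  then show ?case
    using step.IH[of "succs r S"] step.hyps step.prems final_extensions_succs[of r S]
      sum_reach_succs[of r S] by simp
qed

text \<open>A final signal has one truncation to phase \<open>r\<close>, hence extends members of at
  most one cell of \<open>D\<close>.\<close>

lemma sum_final_extensions_partition:
  assumes "r \<le> phases G" "S \<subseteq> signals G r" "partition_on S D"
  shows "(\<Sum>\<theta> \<in> final_extensions G S. g \<theta>) = (\<Sum>d \<in> D. \<Sum>\<theta> \<in> final_extensions G d. g \<theta>)"
proof -
  have fin: "finite (signals G (phases G))" "finite S" "finite D"
    using assms finite_signals by (auto intro: finite_subset finite_elements)
  have sub: "d \<subseteq> signals G r" if "d \<in> D" for d
    using that assms(2,3) by (auto simp: partition_on_def)
  have "final_extensions G S = (\<Union>d\<in>D. final_extensions G d)"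
    using assms(3) by (auto simp: final_extensions_def partition_on_def)
  also have "(\<Sum>\<theta> \<in> (\<Union>d\<in>D. final_extensions G d). g \<theta>)
      = (\<Sum>d \<in> D. \<Sum>\<theta> \<in> final_extensions G d. g \<theta>)"
  proof (rule sum.UNION_disjoint)
    show "\<forall>d\<in>D. finite (final_extensions G d)"
      using fin(1) by (simp add: final_extensions_def)
    show "\<forall>d\<in>D. \<forall>e\<in>D. d \<noteq> e \<longrightarrow> final_extensions G d \<inter> final_extensions G e = {}"
      using sub assms(1,3)
      by (auto simp: final_extensions_take[of r] partition_on_def dest: disjointD)
  qed (rule fin(3))
  finally show ?thesis .
qed


section \<open>Rates are functions of the features\<close>

abbreviation rate :: "('a list \<Rightarrow> bool) \<Rightarrow> 'a list set \<Rightarrow> real" where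
  "rate P \<psi> \<equiv> event_rate G (final_extensions G \<psi>) P"

text \<open>Unnormalised: dividing by the reach mass of \<psi> gives the transition probability from
  \<psi> to \<psi>'.\<close>

abbreviation transit :: "'a list set \<Rightarrow> 'a list set \<Rightarrow> real" where
  "transit \<psi> \<psi>' \<equiv> (\<Sum>\<theta> \<in> \<psi>. reach_prob G \<theta> * (\<Sum>\<theta>' \<in> \<psi>'. deal_prob G \<theta> \<theta>'))"

lemma infoset_reach_pos:
  assumes "r \<in> {1..phases G}" "\<psi> \<in> infosets G i r"
  shows "(\<Sum>\<theta> \<in> \<psi>. reach_prob G \<theta>) > 0"
proof (rule sum_pos)
  show "finite \<psi>" using finite_infoset[OF assms] .
  show "\<psi> \<noteq> {}" using partition_infosets[OF assms(1)] assms(2) by (auto simp: partition_on_def)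
  show "reach_prob G \<theta> > 0" if "\<theta> \<in> \<psi>" for \<theta>
    using that infoset_subset[OF assms] reach_prob_pos assms(1) by auto
qed

text \<open>By conservation of mass the denominator of the rate is the reach mass of \<psi>, which
  is positive and can be cleared.\<close>

lemma final_mass_eq_rate_times_reach:
  assumes "r \<in> {1..phases G}" "\<psi> \<in> infosets G i r"
  shows "(\<Sum>\<theta> \<in> final_extensions G \<psi>. reach_prob G \<theta> * of_bool (P \<theta>))
    = rate P \<psi> * (\<Sum>\<theta> \<in> \<psi>. reach_prob G \<theta>)"
  using infoset_reach_pos[OF assms] sum_reach_final_extensions[of r \<psi>] infoset_subset[OF assms] assms(1)
  by (simp add: event_rate_def)

text \<open>The law of total probability over the next-phase infosets, with perfect recall ensuring
  that none of them lies only partly below \<psi>.\<close>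

lemma rate_eq_sum_transit:
  assumes "r \<in> {1..<phases G}" "\<psi> \<in> infosets G i r"
  shows "rate P \<psi> = (\<Sum>\<psi>' \<in> infosets G i (Suc r). rate P \<psi>' * transit \<psi> \<psi>')
    / (\<Sum>\<theta> \<in> \<psi>. reach_prob G \<theta>)"
proof -
  let ?\<Psi>' = "infosets G i (Suc r)"
  let ?mass = "\<lambda>S. \<Sum>\<theta> \<in> final_extensions G S. reach_prob G \<theta> * of_bool (P \<theta>)"
  have r: "r < phases G" "r \<in> {1..phases G}" "Suc r \<in> {1..phases G}"
    using assms(1) by auto
  have part: "partition_on (signals G (Suc r)) ?\<Psi>'"
    using partition_infosets[OF r(3)] .
  have sub: "\<psi> \<subseteq> signals G r" "\<And>\<psi>'. \<psi>' \<in> ?\<Psi>' \<Longrightarrow> \<psi>' \<subseteq> signals G (Suc r)"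
    using infoset_subset r assms(2) by blast+
  \<comment> \<open>Perfect recall puts all predecessors of \<psi>' in one infoset \<phi>, which is
    either \<psi> or disjoint from it.\<close>
  have dichotomy: "\<psi>' \<subseteq> succs r \<psi> \<or> \<psi>' \<inter> succs r \<psi> = {}" if \<psi>': "\<psi>' \<in> ?\<Psi>'" for \<psi>'
  proof -
    obtain \<phi> where \<phi>: "\<phi> \<in> infosets G i r" "\<And>\<theta>'. \<theta>' \<in> \<psi>' \<Longrightarrow> butlast \<theta>' \<in> \<phi>"
      using perfect_recall[OF assms(1) \<psi>'] by blast
    have "\<phi> = \<psi> \<or> \<phi> \<inter> \<psi> = {}"
      using partition_infosets[OF r(2)] \<phi>(1) assms(2) by (auto simp: partition_on_def dest: disjointD)
    then show ?thesis
      using \<phi>(2) sub(2)[OF \<psi>'] by (auto simp: succs_def)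
  qed
  define Ch where "Ch = {\<psi>' \<in> ?\<Psi>'. \<psi>' \<subseteq> succs r \<psi>}"
  have "partition_on (succs r \<psi>) Ch"
  proof (rule partition_onI)
    show "\<Union>Ch = succs r \<psi>"
    proof
      show "succs r \<psi> \<subseteq> \<Union>Ch"
      proof
        fix \<theta> assume \<theta>: "\<theta> \<in> succs r \<psi>"
        then obtain \<psi>' where "\<psi>' \<in> ?\<Psi>'" "\<theta> \<in> \<psi>'"
          using part by (auto simp: succs_def partition_on_def)
        then show "\<theta> \<in> \<Union>Ch"
          using dichotomy \<theta> by (auto simp: Ch_def)
      qed
    qed (auto simp: Ch_def)
  qed (use part in \<open>auto simp: Ch_def partition_on_def disjnt_def dest: disjointD\<close>)
  moreover have "succs r \<psi> \<subseteq> signals G (Suc r)"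
    by (auto simp: succs_def)
  ultimately have "?mass (succs r \<psi>) = (\<Sum>\<psi>'\<in>Ch. ?mass \<psi>')"
    using r by (intro sum_final_extensions_partition[of "Suc r"]) auto
  also have "\<dots> = (\<Sum>\<psi>'\<in>Ch. rate P \<psi>' * transit \<psi> \<psi>')"
  proof (rule sum.cong)
    fix \<psi>' assume "\<psi>' \<in> Ch"
    then have "\<psi>' \<in> ?\<Psi>'" "\<psi>' \<inter> succs r \<psi> = \<psi>'"
      by (auto simp: Ch_def)
    then show "?mass \<psi>' = rate P \<psi>' * transit \<psi> \<psi>'"
      using final_mass_eq_rate_times_reach[OF r(3)] sum_reach_deal[OF r(1) sub(1) sub(2)] by simp
  qed simp
  \<comment> \<open>Infosets off \<psi> receive no transition mass, so the sum may range over the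
    whole next phase.\<close>
  also have "\<dots> = (\<Sum>\<psi>'\<in>?\<Psi>'. rate P \<psi>' * transit \<psi> \<psi>')"
  proof (rule sum.mono_neutral_left)
    show "\<forall>\<psi>'\<in>?\<Psi>' - Ch. rate P \<psi>' * transit \<psi> \<psi>' = 0"
    proof
      fix \<psi>' assume *: "\<psi>' \<in> ?\<Psi>' - Ch"
      then have "\<psi>' \<inter> succs r \<psi> = {}"
        using dichotomy[of \<psi>'] by (auto simp: Ch_def)
      then show "rate P \<psi>' * transit \<psi> \<psi>' = 0"
        using sum_reach_deal[OF r(1) sub(1) sub(2)] * by simp
    qed
  qed (use finite_infosets[OF r(3)] in \<open>auto simp: Ch_def\<close>)
  finally show ?thesis
    using final_extensions_succs[OF r(1) sub(1)] sum_reach_final_extensions[OF _ sub(1)] r(1)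
    by (simp add: event_rate_def)
qed

text \<open>Backward induction on the phase. At the final phase the rate of \<open>P\<close> is
  itself a component of the feature; earlier, it is a combination of the components with
  coefficients independent of the infoset.\<close>

lemma rate_eq_if_paof_eq:
  assumes "r \<in> {1..phases G}" "\<psi>\<^sub>1 \<in> infosets G i r" "\<psi>\<^sub>2 \<in> infosets G i r"
    and "paof G i r \<psi>\<^sub>1 = paof G i r \<psi>\<^sub>2" "P \<in> {wins G i, ties G i}"
  shows "rate P \<psi>\<^sub>1 = rate P \<psi>\<^sub>2"
proof -
  have "r \<le> phases G" using assms(1) by simp
  then show ?thesis using assms(1-4)
  proof (induction r arbitrary: \<psi>\<^sub>1 \<psi>\<^sub>2 rule: inc_induct)
    case base
    then have "final_extensions G \<psi>\<^sub>1 = \<psi>\<^sub>1" "final_extensions G \<psi>\<^sub>2 = \<psi>\<^sub>2"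
      using final_extensions_final[OF infoset_subset[OF base.prems(1)]] by auto
    then show ?case
      using base.prems(4) assms(5) by (auto simp: paof.simps)
  next
    case (step r)
    let ?\<Psi>' = "infosets G i (Suc r)"
    let ?K = "feature_classes ?\<Psi>' (paof G i (Suc r))"
    have r: "r \<in> {1..<phases G}" "Suc r \<in> {1..phases G}"
      using step by auto
    have part: "partition_on ?\<Psi>' ?K"
      by (rule partition_on_feature_classes)
    have fin: "finite ?\<Psi>'"
      using finite_infosets[OF r(2)] .
    \<comment> \<open>The common rate on the class \<open>C\<close>, read off an arbitrary
      representative; the induction hypothesis makes it independent of the choice.\<close>
    define \<rho> where "\<rho> C = rate P (SOME \<psi>'. \<psi>' \<in> C)" for C
    have \<rho>: "rate P \<psi>' = \<rho> C" if "C \<in> ?K" "\<psi>' \<in> C" for \<psi>' C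
    proof -
      have "(SOME \<psi>'. \<psi>' \<in> C) \<in> C"
        using that(2) by (rule someI)
      then have "\<psi>' \<in> ?\<Psi>'" "(SOME \<psi>'. \<psi>' \<in> C) \<in> ?\<Psi>'"
        "paof G i (Suc r) \<psi>' = paof G i (Suc r) (SOME \<psi>'. \<psi>' \<in> C)"
        using that unfolding feature_classes_def by fastforce+
      then show ?thesis
        unfolding \<rho>_def by (rule step.IH[OF r(2)])
    qed
    \<comment> \<open>Grouping the law of total probability by classes: the quotients are the
      components of the feature of \<psi>, and only they depend on \<psi>.\<close>
    have expand: "rate P \<psi> = (\<Sum>C\<in>?K. \<rho> C *
        ((\<Sum>\<theta> \<in> \<psi>. reach_prob G \<theta> * (\<Sum>\<psi>' \<in> C. \<Sum>\<theta>' \<in> \<psi>'. deal_prob G \<theta> \<theta>'))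
         / (\<Sum>\<theta> \<in> \<psi>. reach_prob G \<theta> * (\<Sum>\<theta>' \<in> signals G (Suc r). deal_prob G \<theta> \<theta>'))))"
      if "\<psi> \<in> infosets G i r" for \<psi>
    proof -
      have sub: "\<psi> \<subseteq> signals G r"
        using infoset_subset that r(1) by auto
      have "(\<Sum>\<psi>' \<in> ?\<Psi>'. rate P \<psi>' * transit \<psi> \<psi>')
          = (\<Sum>C\<in>?K. \<Sum>\<psi>'\<in>C. rate P \<psi>' * transit \<psi> \<psi>')"
        by (rule sum_over_partition[OF part fin])
      also have "\<dots> = (\<Sum>C\<in>?K. \<rho> C * (\<Sum>\<psi>'\<in>C. transit \<psi> \<psi>'))"
        by (simp add: \<rho> sum_distrib_left)
      also have "\<dots> = (\<Sum>C\<in>?K. \<rho> C *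
          (\<Sum>\<theta> \<in> \<psi>. reach_prob G \<theta> * (\<Sum>\<psi>' \<in> C. \<Sum>\<theta>' \<in> \<psi>'. deal_prob G \<theta> \<theta>')))"
        \<comment> \<open>The sum over the infosets of a class moves inside the sum over the signals
          of \<psi>.\<close>
        by (subst sum.swap) (simp add: sum_distrib_left)
      finally show ?thesis
        using r(1)
        by (simp only: rate_eq_sum_transit[OF r(1) that] sum_reach_total[OF _ sub]
            times_divide_eq_right atLeastLessThan_iff flip: sum_divide_distrib)
    qed
    \<comment> \<open>Equal feature lists agree at every entry of the enumeration, hence at every
      class.\<close>
    have "set (enumeration ?K) = ?K"
      using set_enumeration finite_elements[OF fin part] by blast
    then show ?case
      unfolding expand[OF step.prems(2)] expand[OF step.prems(3)]
      using step.prems(4) r(1) by (intro sum.cong) (auto simp: paof.simps[of G i r] map_eq_conv)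
  qed
qed


section \<open>The two abstractions\<close>

lemma partition_paoi_classes: "partition_on (infosets G i r) (paoi_classes G i r)"
  unfolding paoi_classes_def by (rule partition_on_feature_classes)

text \<open>Winning and tying exclude each other, so the two rates sum to at most 1, and halving the
  tying rate only lowers the sum.\<close>

lemma equity_bounds:
  "0 \<le> equity G i \<psi>" "equity G i \<psi> \<le> 1"
proof -
  let ?F = "final_extensions G \<psi>"
  have pos: "reach_prob G \<theta> \<ge> 0" if "\<theta> \<in> ?F" for \<theta>
    using that reach_prob_pos[of "phases G" \<theta>] by (simp add: final_extensions_def)
  have nonneg: "0 \<le> rate P \<psi>" for P
    unfolding event_rate_def using pos by (intro divide_nonneg_nonneg sum_nonneg) auto
  then show "0 \<le> equity G i \<psi>"
    by (simp add: equity_def)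
  have "rate (wins G i) \<psi> + rate (ties G i) \<psi>
      = (\<Sum>\<theta>\<in>?F. reach_prob G \<theta> * (of_bool (wins G i \<theta>) + of_bool (ties G i \<theta>)))
        / (\<Sum>\<theta>\<in>?F. reach_prob G \<theta>)"
    unfolding event_rate_def by (simp add: sum.distrib distrib_left add_divide_distrib)
  also have "\<dots> \<le> 1"
  \<comment> \<open>The total mass is 0 when \<psi> has no final extension; the quotient is then 0
    by convention.\<close>
  proof (rule divide_le_eq_1[THEN iffD2], goal_cases)
    case 1
    have "(\<Sum>\<theta>\<in>?F. reach_prob G \<theta> * (of_bool (wins G i \<theta>) + of_bool (ties G i \<theta>)))
        \<le> (\<Sum>\<theta>\<in>?F. reach_prob G \<theta>)"
      using pos by (intro sum_mono) (auto simp: wins_def ties_def)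
    moreover have "(\<Sum>\<theta>\<in>?F. reach_prob G \<theta>) \<ge> 0"
      using pos by (rule sum_nonneg)
    ultimately show ?case by auto
  qed
  finally show "equity G i \<psi> \<le> 1"
    using nonneg[of "ties G i"] by (simp add: equity_def)
qed

lemma partition_ehs_clusters:
  assumes "p \<in> ehs_params G" "r \<in> {1..phases G}"
  shows "partition_on (infosets G i r) (ehs_clusters G i p r)"
  unfolding ehs_clusters_def
proof (rule partition_on_preimages)
  show "partition_on {0..1} (snd (p r))"
    using assms by (auto simp: ehs_params_def interval_division_def)
  show "equity G i ` infosets G i r \<subseteq> {0..1}"
    using equity_bounds by auto
qed

section \<open>Refinement between abstractions built from classes of infosets\<close>

lemma signal_abstraction_Union_image:
  assumes "\<And>r. r \<in> {1..phases G} \<Longrightarrow> partition_on (infosets G i r) (K r)"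
  shows "signal_abstraction G i (\<lambda>r. Union ` K r)"
  unfolding signal_abstraction_def
proof (intro ballI conjI)
  fix r assume r: "r \<in> {1..phases G}"
  show "partition_on (signals G r) (Union ` K r)"
    using partition_infosets[OF r] assms[OF r] by (rule partition_on_Union_image)
  show "\<exists>S\<subseteq>infosets G i r. c = \<Union>S" if "c \<in> Union ` K r" for c
    using that assms[OF r] by (auto simp: partition_on_def)
qed

lemma abstraction_refines_Union_image:
  assumes "\<And>r. r \<in> {1..phases G} \<Longrightarrow> partition_on (infosets G i r) (K r)"
    and "\<And>r. r \<in> {1..phases G} \<Longrightarrow> partition_on (infosets G i r) (L r)"
    and "\<And>r k. r \<in> {1..phases G} \<Longrightarrow> k \<in> K r \<Longrightarrow> \<exists>l \<in> L r. k \<subseteq> l"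
  shows "abstraction_refines G i (\<lambda>r. Union ` K r) (\<lambda>r. Union ` L r)"
  unfolding abstraction_refines_def
proof (intro conjI ballI)
  fix r c assume r: "r \<in> {1..phases G}" and "c \<in> Union ` L r"
  then obtain l where l: "l \<in> L r" "c = \<Union>l"
    by blast
  have "l = \<Union>{k \<in> K r. k \<subseteq> l}"
    using Union_of_finer_cells[OF assms(1)[OF r] assms(2)[OF r] l(1)] assms(3)[OF r] by blast
  then obtain S where S: "S \<subseteq> K r" "l = \<Union>S"
    by (metis (no_types, lifting) mem_Collect_eq subsetI)
  have "c = \<Union>(Union ` S)"
    unfolding l(2) S(2) by blast
  then show "\<exists>S\<subseteq>Union ` K r. c = \<Union>S"
    using S(1) by (intro exI[of _ "Union ` S"]) auto
qed (rule signal_abstraction_Union_image; use assms in blast)+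

lemma equity_eq_if_paof_eq:
  assumes "r \<in> {1..phases G}" "\<psi> \<in> infosets G i r" "\<psi>' \<in> infosets G i r"
    and "paof G i r \<psi> = paof G i r \<psi>'"
  shows "equity G i \<psi> = equity G i \<psi>'"
  using rate_eq_if_paof_eq[OF assms, of "wins G i"] rate_eq_if_paof_eq[OF assms, of "ties G i"]
  by (simp add: equity_def)

text \<open>Equity is constant on \<open>K\<close>, and a cluster is the preimage of an interval
  under equity. Hence the cluster of one representative contains all of \<open>K\<close>.\<close>

lemma paoi_class_within_ehs_cluster:
  assumes "p \<in> ehs_params G" "r \<in> {1..phases G}" "K \<in> paoi_classes G i r"
  shows "\<exists>C \<in> ehs_clusters G i p r. K \<subseteq> C"
proof -
  obtain \<psi> where \<psi>: "\<psi> \<in> infosets G i r" "K = {\<psi>' \<in> infosets G i r. paof G i r \<psi>' = paof G i r \<psi>}"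
    using assms(3) by (auto simp: paoi_classes_def feature_classes_def)
  then have eq: "equity G i \<psi>' = equity G i \<psi>" if "\<psi>' \<in> K" for \<psi>'
    using that equity_eq_if_paof_eq[OF assms(2)] by blast
  obtain C where C: "C \<in> ehs_clusters G i p r" "\<psi> \<in> C"
    using partition_ehs_clusters[OF assms(1,2)] \<psi>(1) by (auto simp: partition_on_def)
  then obtain J where "C = {\<psi>' \<in> infosets G i r. equity G i \<psi>' \<in> J}"
    unfolding ehs_clusters_def by blast
  moreover have "K \<subseteq> infosets G i r"
    using \<psi>(2) by blast
  ultimately have "K \<subseteq> C"
    using eq C(2) by (metis (mono_tags, lifting) mem_Collect_eq subset_iff)
  with C(1) show ?thesis by blast
qed

end

theorem proposition4p3:
  fixes G :: "'a holdem" and i :: player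
  assumes "holdem_game G"
  shows "resolution_bound G i (paoi G i) (ehs_params G) (ehs G i)
    \<and> (\<forall>p \<in> ehs_params G. \<forall>r \<in> {1..phases G}. \<forall>K \<in> paoi_classes G i r. \<forall>\<psi> \<in> K. \<forall>\<psi>' \<in> K.
         \<exists>C \<in> ehs_clusters G i p r. \<psi> \<in> C \<and> \<psi>' \<in> C)"
proof -
  interpret holdem G
    using assms by unfold_locales
  have paoi: "paoi G i = (\<lambda>r. Union ` paoi_classes G i r)"
    by (simp add: fun_eq_iff paoi_def)
  have ehs: "ehs G i p = (\<lambda>r. Union ` ehs_clusters G i p r)" for p
    by (simp add: fun_eq_iff ehs_def)
  have "signal_abstraction G i (paoi G i)"
    unfolding paoi by (intro signal_abstraction_Union_image partition_paoi_classes)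
  moreover have "abstraction_refines G i (paoi G i) (ehs G i p)" if "p \<in> ehs_params G" for p
    unfolding paoi ehs using that
    by (intro abstraction_refines_Union_image partition_paoi_classes partition_ehs_clusters
        paoi_class_within_ehs_cluster)
  \<comment> \<open>The statement about pairs follows because a single cluster contains the whole
    class.\<close>
  ultimately show ?thesis
    unfolding resolution_bound_def by (meson paoi_class_within_ehs_cluster subsetD)
qed

end
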